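(* Let $\mathcal C$ be an algebraic plane curve over $\mathbb C$ defined by an irreducible polynomial $f\in\mathbb R[x,y]$, such that $(0:1:0)$ is not an infinity point of $\mathcal C$. Suppose that $\mathcal C$ has a unique infinity point $P$ and that $P$ is regular (i.e. a non-singular point of the projective closure of $\mathcal C$). Then $\mathcal C$ is perfect.
   Context: Curves. A plane curve over $\mathbb C$ is the zero set in $\mathbb C^2$ of an irreducible polynomial $f\in\mathbb C[x,y]$ of degree $d\ge 1$; $d$ is the degree of the curve. Write $f=f_d+f_{d-1}+\cdots+f_0$ with $f_i$ homogeneous of degree $i$, and $F(x,y,z)=f_d+zf_{d-1}+\cdots+z^df_0$ for the polynomial of its projective closure. The infinity points are the points $(a:b:0)$ with $f_d(a,b)=0$. Infinity branches. Let $\mathcal C$ be a curve and $(1:m:0)$, $m\in\mathbb C$, an infinity point. Put $g(y,z)=F(1,y,z)$. Let $\varphi(z)=m+a_1z^{N_1/N}+a_2z^{N_2/N}+\cdots$ (finitely or infinitely many terms, $a_i\ne0$, $N,N_i\in\mathbb N$, $0<N_1<N_2<\cdots$) be a Puiseux series with $g(\varphi(z),z)=0$ and ramification index $N$ (the least common denominator of its exponents). Its conjugates are $\varphi_j(z)=m+a_1c_j^{N_1}z^{N_1/N}+a_2c_j^{N_2}z^{N_2/N}+\cdots$, where $c_1,\dots,c_N$ are the $N$-th roots of unity. Put $r_j(z)=z\varphi_j(z^{-1})$, which converges for $|z|>M$ for some $M>0$. The set $B=\bigcup_{j=1}^N L_j$, with leaves $L_j=\{(z,r_j(z))\in\mathbb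 C^2: |z|>M\}$, is an infinity branch of $\mathcal C$ associated to $(1:m:0)$. Approaching curves. Let $d(p,\overline{\mathcal C})$ be the usual distance in $\mathbb C^2$ from a point $p$ to a curve $\overline{\mathcal C}$. A curve $\overline{\mathcal C}$ approaches $\mathcal C$ at its infinity branch $B$ if there is a leaf $\{(z,r(z)):|z|>M\}\subset B$ with $\lim_{z\to\infty}d((z,r(z)),\overline{\mathcal C})=0$. Perfect curves. A curve of degree $d$ (not having $(0:1:0)$ as infinity point) is perfect if it cannot be approached, at any of its infinity branches, by any curve over $\mathbb C$ of degree less than $d$. *)

theory Defs
  imports "HOL-Analysis.Analysis" "HOL-Computational_Algebra.Polynomial_Factorial"
begin

text \<open>
  A polynomial f in R[x,y] is an element of \<open>R[x][y]\<close>: the coefficient of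
  \<open>x^i * y^j\<close> is \<open>coeff (coeff f j) i\<close>. The notion \<^const>\<open>irreducible\<close> on this type is
  irreducibility in R[x,y]. A plane curve over the complex numbers is given by its defining
  polynomial, an irreducible element of type \<^typ>\<open>complex poly poly\<close>; irreducible elements are
  neither zero nor units, hence have total degree at least 1.
\<close>

definition poly2 :: "'a::comm_ring_1 poly poly \<Rightarrow> 'a \<Rightarrow> 'a \<Rightarrow> 'a" where
  "poly2 f x y = poly (poly f [:y:]) x"

definition map_poly2 :: "('a::zero \<Rightarrow> 'b::zero) \<Rightarrow> 'a poly poly \<Rightarrow> 'b poly poly" where
  "map_poly2 h = map_poly (map_poly h)"

definition total_degree :: "'a::zero poly poly \<Rightarrow> nat" where
  "total_degree f = Max (insert 0 {i + j |i j. coeff (coeff f j) i \<noteq> 0})"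

definition zero_set :: "complex poly poly \<Rightarrow> (complex \<times> complex) set" where
  "zero_set f = {(x, y). poly2 f x y = 0}"

definition hom_part :: "'a::comm_ring_1 poly poly \<Rightarrow> nat \<Rightarrow> 'a \<Rightarrow> 'a \<Rightarrow> 'a" where
  "hom_part f k x y = (\<Sum>i\<le>k. coeff (coeff f (k - i)) i * x ^ i * y ^ (k - i))"

text \<open>
  The form F(x,y,z) of the projective closure. The coefficient ring is arbitrary so that F can
  also be evaluated at formal power series.
\<close>

definition proj_closure :: "'a::comm_ring_1 poly poly \<Rightarrow> 'a \<Rightarrow> 'a \<Rightarrow> 'a \<Rightarrow> 'a" where
  "proj_closure f x y z =
     (\<Sum>k\<le>total_degree f. z ^ (total_degree f - k) * hom_part f k x y)"

text \<open>Points of the line at infinity are given by homogeneous coordinates: (a, b) stands for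
  (a : b : 0).\<close>

definition infinity_point :: "complex poly poly \<Rightarrow> complex \<times> complex \<Rightarrow> bool" where
  "infinity_point f = (\<lambda>(a, b). (a, b) \<noteq> (0, 0) \<and> hom_part f (total_degree f) a b = 0)"

definition proj_eq :: "complex \<times> complex \<Rightarrow> complex \<times> complex \<Rightarrow> bool" where
  "proj_eq P Q \<longleftrightarrow> (\<exists>c. c \<noteq> 0 \<and> fst P = c * fst Q \<and> snd P = c * snd Q)"

definition regular_point :: "complex poly poly \<Rightarrow> complex \<times> complex \<times> complex \<Rightarrow> bool" where
  "regular_point f = (\<lambda>(a, b, c).
     (a, b, c) \<noteq> (0, 0, 0) \<and> proj_closure f a b c = 0 \<and>
     (deriv (\<lambda>t. proj_closure f t b c) a \<noteq> 0 \<or>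
      deriv (\<lambda>t. proj_closure f a t c) b \<noteq> 0 \<or>
      deriv (\<lambda>t. proj_closure f a b t) c \<noteq> 0))"

text \<open>
  The Puiseux series \<open>\<Sum>k. \<alpha> k * z^(k/N)\<close> is encoded by N and the power series A with coefficients
  \<open>\<alpha>\<close>, the variable of A being \<open>z^(1/N)\<close>. Functions of z use the principal N-th root; the
  conjugates account for the other determinations.
\<close>

definition puiseux_eval :: "nat \<Rightarrow> complex fps \<Rightarrow> complex \<Rightarrow> complex" where
  "puiseux_eval N A z = eval_fps A (z powr (1 / of_nat N))"

definition puiseux_conj :: "complex \<Rightarrow> complex fps \<Rightarrow> complex fps" where
  "puiseux_conj c A = Abs_fps (\<lambda>k. fps_nth A k * c ^ k)"

definition leaf_fun :: "nat \<Rightarrow> complex fps \<Rightarrow> complex \<Rightarrow> complex" where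
  "leaf_fun N A z = z * puiseux_eval N A (inverse z)"

definition leaf :: "nat \<Rightarrow> complex fps \<Rightarrow> real \<Rightarrow> (complex \<times> complex) set" where
  "leaf N A M = {(z, leaf_fun N A z) |z. cmod z > M}"

definition branch_set :: "nat \<Rightarrow> complex fps \<Rightarrow> real \<Rightarrow> (complex \<times> complex) set" where
  "branch_set N A M = (\<Union>c\<in>{c. c ^ N = 1}. leaf N (puiseux_conj c A) M)"

text \<open>
  In the following definition the condition on \<^const>\<open>Gcd\<close> says that N is the least common
  denominator of the exponents k/N that occur; the condition on \<^const>\<open>proj_closure\<close> is
  \<open>g(\<phi>(z), z) = F(1, \<phi>(z), z) = 0\<close> as an identity of formal series in \<open>t = z^(1/N)\<close>; the last
  condition says that all the series \<open>r\<^sub>j(z)\<close> converge for \<open>|z| > M\<close>.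
\<close>

definition branch_data ::
  "complex poly poly \<Rightarrow> complex \<Rightarrow> nat \<Rightarrow> complex fps \<Rightarrow> real \<Rightarrow> bool" where
  "branch_data f m N A M \<longleftrightarrow>
     infinity_point f (1, m) \<and> N > 0 \<and> fps_nth A 0 = m \<and>
     Gcd (insert N {k. fps_nth A k \<noteq> 0}) = 1 \<and>
     proj_closure (map_poly2 fps_const f) 1 A (fps_X ^ N) = 0 \<and>
     M > 0 \<and> ereal ((1 / M) powr (1 / real N)) \<le> fps_conv_radius A"

definition infinity_branch ::
  "complex poly poly \<Rightarrow> complex \<Rightarrow> (complex \<times> complex) set \<Rightarrow> bool" where
  "infinity_branch f m B \<longleftrightarrow> (\<exists>N A M. branch_data f m N A M \<and> B = branch_set N A M)"

text \<open>The curve of g approaches the curve of f at its infinity branch B. Distances are taken in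
  the Euclidean metric of \<^typ>\<open>complex \<times> complex\<close>.\<close>

definition approaches_at ::
  "complex poly poly \<Rightarrow> complex poly poly \<Rightarrow> (complex \<times> complex) set \<Rightarrow> bool" where
  "approaches_at g f B \<longleftrightarrow>
     (\<exists>m N A M c. branch_data f m N A M \<and> B = branch_set N A M \<and> c ^ N = 1 \<and>
        ((\<lambda>z. infdist (z, leaf_fun N (puiseux_conj c A) z) (zero_set g)) \<longlongrightarrow> 0) at_infinity)"

definition perfect_curve :: "complex poly poly \<Rightarrow> bool" where
  "perfect_curve f \<longleftrightarrow>
     irreducible f \<and> \<not> infinity_point f (0, 1) \<and>
     (\<forall>m B. infinity_branch f m B \<longrightarrow>
        (\<forall>g. irreducible g \<and> total_degree g < total_degree f \<longrightarrow> \<not> approaches_at g f B))"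

end

theory Submission
  imports Defs "HOL-Computational_Algebra.Fundamental_Theorem_Algebra"
begin

text \<open>
  Let \<open>q\<^sub>k(y) = f\<^sub>k(1, y)\<close>. Since \<open>(1:m:0)\<close> is the only infinity point, \<open>q\<^sub>d = a (y - m)\<^sup>d\<close>, and
  for \<open>d \<ge> 2\<close> regularity says \<open>q\<^sub>d\<^sub>-\<^sub>1(m) \<noteq> 0\<close>. If \<open>f = g h\<close> with nonconstant factors, both
  leading forms vanish at \<open>(1, m)\<close>, hence so does \<open>f\<^sub>d\<^sub>-\<^sub>1\<close>; so \<open>f\<close> is irreducible over the
  complex numbers.

  Substituting the Puiseux series into \<open>F(1, y, 1/z) = 0\<close> gives
  \<open>(r(z) - m z)\<^sup>d \<sim> - (q\<^sub>d\<^sub>-\<^sub>1(m) / a) z\<^sup>d\<^sup>-\<^sup>1\<close> on every leaf. A curve \<open>g = 0\<close> that approaches the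
  leaf has points \<open>(x, m x + w)\<close> with \<open>|w|\<^sup>d / |x|\<^sup>d\<^sup>-\<^sup>1\<close> tending to a nonzero limit. In
  \<open>g(x, m x + w)\<close> the monomial \<open>x\<^sup>i w\<^sup>j\<close> has the growth of \<open>|x|\<close> to the power \<open>i + j - j/d\<close>, and for
  \<open>j < d\<close> these exponents are pairwise distinct, so a single monomial dominates and the
  polynomial cannot vanish there.
\<close>

subsection \<open>Forms and total degree\<close>

lemma poly2_mult: "poly2 (f * g) x y = poly2 f x y * poly2 g x y"
  by (simp add: poly2_def)

text \<open>For fixed y the polynomial f(., y) has infinitely many roots and so is zero. Hence f,
  read over the polynomials in x, has every constant \<open>[:y:]\<close> as a root, too many for a
  nonzero polynomial.\<close>

lemma poly2_eq_0_imp_eq_0: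
  fixes f :: "'a::{idom,ring_char_0} poly poly"
  assumes "\<And>x y. poly2 f x y = 0"
  shows "f = 0"
proof (rule ccontr)
  assume "f \<noteq> 0"
  have "poly f [:y:] = 0" for y
    using assms by (simp add: poly2_def poly_all_0_iff_0[symmetric])
  then have "range (\<lambda>y. [:y:]) \<subseteq> {p. poly f p = 0}"
    by auto
  then have "finite (range (\<lambda>y::'a. [:y:]))"
    using poly_roots_finite[OF \<open>f \<noteq> 0\<close>] by (rule finite_subset)
  then have "finite (UNIV :: 'a set)"
    by (rule finite_imageD) (simp add: inj_on_def)
  then show False
    using infinite_UNIV_char_0 by blast
qed

lemma poly2_eqI:
  fixes f g :: "'a::{idom,ring_char_0} poly poly"
  assumes "\<And>x y. poly2 f x y = poly2 g x y"
  shows "f = g"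
  using poly2_eq_0_imp_eq_0[of "f - g"] assms by (simp add: poly2_def)

section \<open>Total degree and homogeneous parts\<close>

lemma finite_exponents: "finite {i + j |i j. coeff (coeff f j) i \<noteq> 0}"
proof -
  have "{i + j |i j. coeff (coeff f j) i \<noteq> 0} \<subseteq>
      (\<Union>j\<le>degree f. (\<lambda>i. i + j) ` {..degree (coeff f j)})"
  proof
    fix k assume "k \<in> {i + j |i j. coeff (coeff f j) i \<noteq> 0}"
    then obtain i j where k: "k = i + j" "coeff (coeff f j) i \<noteq> 0" by blast
    then have "j \<le> degree f" "i \<le> degree (coeff f j)"
      by (auto intro!: le_degree)
    then show "k \<in> (\<Union>j\<le>degree f. (\<lambda>i. i + j) ` {..degree (coeff f j)})"
      using k by blast
  qed
  then show ?thesis by (rule finite_subset) auto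
qed

lemma coeff_coeff_eq_0:
  assumes "total_degree f < i + j"
  shows "coeff (coeff f j) i = 0"
proof (rule ccontr)
  assume "coeff (coeff f j) i \<noteq> 0"
  then have "i + j \<in> insert 0 {i + j |i j. coeff (coeff f j) i \<noteq> 0}" by blast
  then have "i + j \<le> total_degree f"
    unfolding total_degree_def using finite_exponents[of f] by (intro Max_ge) auto
  then show False using assms by simp
qed

lemma total_degree_attained:
  assumes "f \<noteq> 0"
  obtains i j where "i + j = total_degree f" "coeff (coeff f j) i \<noteq> 0"
proof -
  have "total_degree f \<in> insert 0 {i + j |i j. coeff (coeff f j) i \<noteq> 0}"
    unfolding total_degree_def using finite_exponents[of f] by (intro Max_in) auto
  moreover have "\<exists>j i. coeff (coeff f j) i \<noteq> 0"
    using assms by (metis coeff_0 poly_eqI)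
  \<comment> \<open>If the maximum is the inserted 0, any nonzero coefficient still has i + j = 0 by
    \<open>coeff_coeff_eq_0\<close>, so the value 0 is attained by a monomial too.\<close>
  ultimately show thesis
    using that coeff_coeff_eq_0[of f]
    by (smt (verit, best) bot_nat_0.not_eq_extremum add_is_0 insert_iff mem_Collect_eq)
qed

lemma degree_le_total_degree: "degree f \<le> total_degree f"
proof (rule degree_le, intro allI impI)
  fix j assume "total_degree f < j"
  then show "coeff f j = 0"
    by (intro poly_eqI) (simp add: coeff_coeff_eq_0)
qed

lemma poly_eq_sum_le:
  fixes p :: "'a::comm_semiring_1 poly"
  assumes "\<And>i. i > n \<Longrightarrow> coeff p i = 0"
  shows "poly p x = (\<Sum>i\<le>n. coeff p i * x ^ i)"
proof -
  have "degree p \<le> n" using assms by (intro degree_le) auto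
  then have "(\<Sum>i\<le>n. coeff p i * x ^ i) = (\<Sum>i\<le>degree p. coeff p i * x ^ i)"
    by (intro sum.mono_neutral_right) (auto simp: coeff_eq_0)
  then show ?thesis by (subst poly_altdef) simp
qed

lemma poly2_eq_sum_hom_part:
  "poly2 f x y = (\<Sum>k\<le>total_degree f. hom_part f k x y)"
proof -
  let ?d = "total_degree f"
  have "poly f [:y:] = (\<Sum>j\<le>?d. coeff f j * [:y:] ^ j)"
    by (rule poly_eq_sum_le) (auto intro!: poly_eqI simp: coeff_coeff_eq_0)
  then have "poly2 f x y = (\<Sum>j\<le>?d. poly (coeff f j) x * y ^ j)"
    by (simp add: poly2_def poly_sum)
  also have "\<dots> = (\<Sum>j\<le>?d. \<Sum>i\<le>?d - j. coeff (coeff f j) i * x ^ i * y ^ j)"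
  proof (rule sum.cong[OF refl])
    fix j assume "j \<in> {..?d}"
    then have "poly (coeff f j) x = (\<Sum>i\<le>?d - j. coeff (coeff f j) i * x ^ i)"
      by (intro poly_eq_sum_le coeff_coeff_eq_0) auto
    then show "poly (coeff f j) x * y ^ j = (\<Sum>i\<le>?d - j. coeff (coeff f j) i * x ^ i * y ^ j)"
      by (simp add: sum_distrib_right)
  qed
  also have "\<dots> = (\<Sum>(j, i)\<in>{(j, i). j + i \<le> ?d}. coeff (coeff f j) i * x ^ i * y ^ j)"
    by (subst sum.Sigma) (auto intro!: sum.cong)
  also have "\<dots> = (\<Sum>k\<le>?d. \<Sum>j\<le>k. coeff (coeff f j) (k - j) * x ^ (k - j) * y ^ j)"
    by (rule sum.triangle_reindex_eq)
  also have "\<dots> = (\<Sum>k\<le>?d. hom_part f k x y)"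
    unfolding hom_part_def
  proof (rule sum.cong[OF refl])
    fix k
    show "(\<Sum>j\<le>k. coeff (coeff f j) (k - j) * x ^ (k - j) * y ^ j) =
        (\<Sum>i\<le>k. coeff (coeff f (k - i)) i * x ^ i * y ^ (k - i))"
      by (rule sum.reindex_bij_witness[of _ "\<lambda>i. k - i" "\<lambda>i. k - i"]) auto
  qed
  finally show ?thesis .
qed

text \<open>The dehomogenised form f_k(1, y), called q_k in the overview. As a polynomial rather
  than a function it has a degree, a leading coefficient and a factorization.\<close>

definition hom_poly :: "'a::comm_ring_1 poly poly \<Rightarrow> nat \<Rightarrow> 'a poly" where
  "hom_poly f k = (\<Sum>i\<le>k. monom (coeff (coeff f (k - i)) i) (k - i))"

lemma poly_hom_poly: "poly (hom_poly f k) y = hom_part f k 1 y"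
  by (simp add: hom_poly_def hom_part_def poly_sum poly_monom)

lemma coeff_hom_poly:
  "coeff (hom_poly f k) j = (if j \<le> k then coeff (coeff f j) (k - j) else 0)"
proof -
  have "coeff (hom_poly f k) j =
      (\<Sum>i\<le>k. if k - i = j then coeff (coeff f (k - i)) i else 0)"
    by (simp add: hom_poly_def coeff_sum)
  also have "\<dots> = (\<Sum>i\<in>(if j \<le> k then {k - j} else {}). coeff (coeff f (k - i)) i)"
    by (rule sum.mono_neutral_cong_right) (auto split: if_splits)
  finally show ?thesis by simp
qed

lemma degree_hom_poly_le: "degree (hom_poly f k) \<le> k"
  by (rule degree_le) (simp add: coeff_hom_poly)

lemma hom_part_scale: "hom_part f k (c * x) (c * y) = c ^ k * hom_part f k x y"
  unfolding hom_part_def sum_distrib_left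
proof (rule sum.cong[OF refl])
  fix i assume "i \<in> {..k}"
  then have "c ^ k = c ^ i * c ^ (k - i)" by (simp flip: power_add)
  then show "coeff (coeff f (k - i)) i * (c * x) ^ i * (c * y) ^ (k - i) =
      c ^ k * (coeff (coeff f (k - i)) i * x ^ i * y ^ (k - i))"
    by (simp only: power_mult_distrib mult_ac)
qed

lemma hom_part_eq:
  fixes x :: "'a::field"
  assumes "x \<noteq> 0"
  shows "hom_part f k x y = x ^ k * poly (hom_poly f k) (y / x)"
  using hom_part_scale[of f k x 1 "y / x"] assms by (simp add: poly_hom_poly)

text \<open>The polynomial \<open>f(t, t y)\<close>, as a polynomial in \<open>t\<close> over the polynomials in \<open>y\<close>. The
  substitution is multiplicative and turns the total degree into the degree in \<open>t\<close>.\<close>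

definition radial_poly :: "'a::comm_ring_1 poly poly \<Rightarrow> 'a poly poly" where
  "radial_poly f = (\<Sum>k\<le>total_degree f. monom (hom_poly f k) k)"

lemma hom_poly_eq_0: "k > total_degree f \<Longrightarrow> hom_poly f k = 0"
  by (rule poly_eqI) (simp add: coeff_hom_poly coeff_coeff_eq_0)

lemma coeff_radial_poly: "coeff (radial_poly f) k = hom_poly f k"
  by (simp add: radial_poly_def coeff_sum hom_poly_eq_0)

lemma poly2_radial_poly: "poly2 (radial_poly f) y t = poly2 f t (t * y)"
proof -
  have "poly2 (radial_poly f) y t = (\<Sum>k\<le>total_degree f. hom_part f k 1 y * t ^ k)"
    by (simp add: poly2_def radial_poly_def poly_sum poly_monom poly_hom_poly)
  also have "\<dots> = poly2 f t (t * y)"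
    using hom_part_scale[of f _ t 1 y] by (simp add: poly2_eq_sum_hom_part mult.commute)
  finally show ?thesis .
qed

text \<open>Both sides take the value f(t, t y) g(t, t y), and polynomials in characteristic 0 are
  determined by their values. This replaces a computation with convolutions of coefficients.\<close>

lemma radial_poly_mult:
  fixes f g :: "'a::{idom,ring_char_0} poly poly"
  shows "radial_poly (f * g) = radial_poly f * radial_poly g"
  by (rule poly2_eqI) (simp add: poly2_mult poly2_radial_poly)

lemma hom_poly_total_degree_nonzero:
  assumes "f \<noteq> 0"
  shows "hom_poly f (total_degree f) \<noteq> 0"
proof -
  obtain i j where "i + j = total_degree f" "coeff (coeff f j) i \<noteq> 0"
    using assms by (rule total_degree_attained)
  then have "coeff (hom_poly f (total_degree f)) j \<noteq> 0"
    by (auto simp: coeff_hom_poly simp flip: \<open>i + j = total_degree f\<close>)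
  then show ?thesis by auto
qed

lemma degree_radial_poly:
  assumes "f \<noteq> 0"
  shows "degree (radial_poly f) = total_degree f"
proof (rule antisym)
  show "degree (radial_poly f) \<le> total_degree f"
    by (rule degree_le) (simp add: coeff_radial_poly hom_poly_eq_0)
  show "total_degree f \<le> degree (radial_poly f)"
    using hom_poly_total_degree_nonzero[OF assms]
    by (intro le_degree) (simp add: coeff_radial_poly)
qed

text \<open>Degrees in t add over the integral domain of polynomials in y, and the total degree is
  the degree in t of the radial polynomial.\<close>

lemma total_degree_mult:
  fixes f g :: "'a::{idom,ring_char_0} poly poly"
  assumes "f \<noteq> 0" "g \<noteq> 0"
  shows "total_degree (f * g) = total_degree f + total_degree g"
proof -
  have "radial_poly f \<noteq> 0" "radial_poly g \<noteq> 0"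
    using assms hom_poly_total_degree_nonzero coeff_radial_poly by (metis coeff_0)+
  then show ?thesis
    using assms by (simp add: degree_mult_eq radial_poly_mult flip: degree_radial_poly)
qed

lemma total_degree_eq_0_imp:
  assumes "total_degree f = 0"
  shows "f = [:[:coeff (coeff f 0) 0:]:]"
  using assms by (intro poly_eqI) (auto simp: coeff_pCons coeff_coeff_eq_0 split: nat.split)

lemma is_unit_imp_total_degree_eq_0:
  fixes f :: "'a::{idom,ring_char_0} poly poly"
  assumes "f dvd 1"
  shows "total_degree f = 0"
proof -
  obtain g where g: "1 = f * g" using assms by (rule dvdE)
  then have "f \<noteq> 0" "g \<noteq> 0" by auto
  moreover have "total_degree (1 :: 'a poly poly) \<le> 0"
    unfolding total_degree_def by (auto simp: finite_exponents coeff_1 split: if_splits)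
  ultimately show ?thesis
    using total_degree_mult[of f g] g by simp
qed

lemma is_unit_if_total_degree_eq_0:
  fixes f :: "'a::field poly poly"
  assumes "total_degree f = 0" "f \<noteq> 0"
  shows "f dvd 1"
proof -
  have "f = [:[:coeff (coeff f 0) 0:]:]" using assms(1) by (rule total_degree_eq_0_imp)
  moreover from this have "coeff (coeff f 0) 0 \<noteq> 0" using assms(2) by auto
  ultimately show ?thesis
    by (metis is_unit_const_poly_iff is_unit_triv dvd_field_iff is_unit_pCons_iff)
qed

lemma hom_poly_mult_top:
  fixes f g :: "'a::{idom,ring_char_0} poly poly"
  shows "hom_poly (f * g) (total_degree f + total_degree g) =
    hom_poly f (total_degree f) * hom_poly g (total_degree g)"
proof (cases "f = 0 \<or> g = 0")
  case True
  then show ?thesis by (auto simp: hom_poly_def)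
next
  case False
  then show ?thesis
    using coeff_mult_degree_sum[of "radial_poly f" "radial_poly g"]
    by (simp add: degree_radial_poly coeff_radial_poly flip: radial_poly_mult)
qed

text \<open>In the convolution for the coefficient of t^(a+b+1), the bounds a+1 and b+1 on the
  degrees leave only the indices a and a+1. Consequently a common root of both leading forms is a
  root of the second form of the product. Writing the degrees as successors avoids truncated
  subtraction.\<close>

lemma hom_poly_mult_subtop:
  fixes f g :: "'a::{idom,ring_char_0} poly poly"
  assumes "total_degree f = Suc a" "total_degree g = Suc b"
  shows "hom_poly (f * g) (Suc (a + b)) =
    hom_poly f (Suc a) * hom_poly g b + hom_poly f a * hom_poly g (Suc b)"
proof -
  have "hom_poly (f * g) (Suc (a + b)) =
      (\<Sum>i\<le>Suc (a + b). hom_poly f i * hom_poly g (Suc (a + b) - i))"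
    by (simp add: coeff_mult radial_poly_mult flip: coeff_radial_poly)
  also have "\<dots> = (\<Sum>i\<in>{a, Suc a}. hom_poly f i * hom_poly g (Suc (a + b) - i))"
  proof (rule sum.mono_neutral_right)
    show "\<forall>i\<in>{..Suc (a + b)} - {a, Suc a}. hom_poly f i * hom_poly g (Suc (a + b) - i) = 0"
    proof
      fix i assume i: "i \<in> {..Suc (a + b)} - {a, Suc a}"
      then have "i > Suc a \<or> Suc (a + b) - i > Suc b" by auto
      then show "hom_poly f i * hom_poly g (Suc (a + b) - i) = 0"
        using hom_poly_eq_0[of f i] hom_poly_eq_0[of g "Suc (a + b) - i"] assms by auto
    qed
  qed auto
  finally show ?thesis by (simp add: add.commute)
qed

text \<open>Over an algebraically closed field p splits into linear factors, and the multiset of its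
  roots can contain only m.\<close>

lemma power_linear_if_unique_root:
  fixes p :: "'a::alg_closed_field poly"
  assumes "p \<noteq> 0" "\<And>y. poly p y = 0 \<Longrightarrow> y = m"
  shows "p = smult (lead_coeff p) ([:-m, 1:] ^ degree p)"
proof -
  obtain A where A: "size A = degree p" "p = smult (lead_coeff p) (\<Prod>x\<in>#A. [:-x, 1:])"
    using alg_closed_imp_factorization[OF assms(1)] by blast
  have "y = m" if "y \<in># A" for y
  proof -
    have "[:-y, 1:] dvd (\<Prod>x\<in>#A. [:-x, 1:])"
      using that by (intro dvd_prod_mset) auto
    then have "poly (\<Prod>x\<in>#A. [:-x, 1:]) y = 0"
      by (simp add: poly_eq_0_iff_dvd)
    then have "poly p y = 0" by (subst A(2)) simp
    then show ?thesis by (rule assms(2))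
  qed
  then have "A = replicate_mset (degree p) m"
    using A(1) by (metis set_mset_subset_singletonD subsetI singleton_iff)
  then show ?thesis using A(2) by simp
qed

subsection \<open>Growth along a leaf\<close>

lemma total_degree_map_fps_const: "total_degree (map_poly2 fps_const f) = total_degree f"
  by (simp add: total_degree_def map_poly2_def coeff_map_poly)

text \<open>Convergence and value are stated together, here and in the next lemmas, so that
  evaluation can be carried step by step through the polynomial expression F(1, A, t^N).\<close>

lemma eval_fps_mult':
  fixes F G :: "complex fps"
  assumes "norm t < fps_conv_radius F" "norm t < fps_conv_radius G"
  shows "norm t < fps_conv_radius (F * G) \<and> eval_fps (F * G) t = eval_fps F t * eval_fps G t"
  using assms less_le_trans[OF _ fps_conv_radius_mult[of F G], of "ereal (norm t)"]
  by (simp add: eval_fps_mult)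

lemma eval_fps_sum':
  fixes F :: "'i \<Rightarrow> complex fps"
  assumes "\<And>i. i \<in> I \<Longrightarrow> norm t < fps_conv_radius (F i)"
  shows "norm t < fps_conv_radius (\<Sum>i\<in>I. F i) \<and>
    eval_fps (\<Sum>i\<in>I. F i) t = (\<Sum>i\<in>I. eval_fps (F i) t)"
  using assms
proof (induction I rule: infinite_finite_induct)
  case (insert i I)
  then have "norm t < min (fps_conv_radius (F i)) (fps_conv_radius (\<Sum>i\<in>I. F i))"
    by simp
  then have "norm t < fps_conv_radius (F i + (\<Sum>i\<in>I. F i))"
    using fps_conv_radius_add by (rule less_le_trans)
  then show ?case using insert by (simp add: eval_fps_add)
qed simp_all

lemma eval_fps_power':
  fixes F :: "complex fps"
  assumes "norm t < fps_conv_radius F"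
  shows "norm t < fps_conv_radius (F ^ n) \<and> eval_fps (F ^ n) t = eval_fps F t ^ n"
  using assms less_le_trans[OF assms fps_conv_radius_power] by (simp add: eval_fps_power)

lemma eval_fps_hom_part:
  fixes A :: "complex fps"
  assumes t: "norm t < fps_conv_radius A"
  shows "norm t < fps_conv_radius (hom_part (map_poly2 fps_const f) k 1 A) \<and>
    eval_fps (hom_part (map_poly2 fps_const f) k 1 A) t = hom_part f k 1 (eval_fps A t)"
proof -
  have "norm t < fps_conv_radius (fps_const a * A ^ n) \<and>
      eval_fps (fps_const a * A ^ n) t = a * eval_fps A t ^ n" for a n
    using eval_fps_mult'[of t "fps_const a" "A ^ n"] eval_fps_power'[OF t, of n] by simp
  then show ?thesis
    using eval_fps_sum'[of "{..k}" t "\<lambda>i. fps_const (coeff (coeff f (k - i)) i) * A ^ (k - i)"]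
    by (simp add: hom_part_def map_poly2_def coeff_map_poly)
qed

lemma eval_fps_proj_closure:
  fixes A :: "complex fps"
  assumes t: "norm t < fps_conv_radius A"
  shows "eval_fps (proj_closure (map_poly2 fps_const f) 1 A (fps_X ^ N)) t =
    proj_closure f 1 (eval_fps A t) (t ^ N)"
proof -
  let ?H = "\<lambda>k. hom_part (map_poly2 fps_const f) k 1 A"
  have "norm t < fps_conv_radius ((fps_X ^ N) ^ n * ?H k) \<and>
      eval_fps ((fps_X ^ N) ^ n * ?H k) t = (t ^ N) ^ n * hom_part f k 1 (eval_fps A t)" for n k
    using eval_fps_mult'[of t "(fps_X ^ N) ^ n" "?H k"] eval_fps_hom_part[OF t, of f k]
    by (simp flip: power_mult)
  then show ?thesis
    using eval_fps_sum'[of "{..total_degree f}" t "\<lambda>k. (fps_X ^ N) ^ (total_degree f - k) * ?H k"]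
    by (simp add: proj_closure_def total_degree_map_fps_const)
qed

text \<open>The two series agree term by term, so the equation holds whether or not they
  converge.\<close>

lemma eval_puiseux_conj: "eval_fps (puiseux_conj c A) t = eval_fps A (c * t)"
  by (simp add: eval_fps_def puiseux_conj_def power_mult_distrib mult.assoc)

text \<open>Put Y = phi(1/z), which tends to m. Dividing F(1, Y, 1/z) = 0 by 1/z expresses a z (Y -
  m)^d as minus the sum over k < d of z^-(d-1-k) q_k(Y), where only k = d - 1 survives in the limit.
  Since r(z) = z Y, the left side is a (r(z) - m z)^d / z^(d-1).\<close>

lemma leaf_fun_tendsto:
  assumes branch: "branch_data f m N A M" and c: "c ^ N = 1"
    and d: "total_degree f = d" "d > 0"
    and top: "hom_poly f d = smult a ([:-m, 1:] ^ d)" and "a \<noteq> 0"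
  shows "((\<lambda>z. (leaf_fun N (puiseux_conj c A) z - m * z) ^ d / z ^ (d - 1)) \<longlongrightarrow>
    - poly (hom_poly f (d - 1)) m / a) at_infinity"
proof -
  have N: "N > 0" and A0: "fps_nth A 0 = m" and "M > 0"
    and root: "proj_closure (map_poly2 fps_const f) 1 A (fps_X ^ N) = 0"
    and radius: "ereal ((1 / M) powr (1 / real N)) \<le> fps_conv_radius A"
    using branch by (auto simp: branch_data_def)
  have "0 < ereal ((1 / M) powr (1 / real N))" using \<open>M > 0\<close> by simp
  then have pos: "0 < fps_conv_radius A" using radius by (rule less_le_trans)
  \<comment> \<open>The point at which A is evaluated. As c^N = 1, its N-th power is 1/z for every
    conjugate, so one formal identity serves all leaves.\<close>
  define u where "u z = c * inverse z powr (1 / of_nat N)" for z :: complex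
  define Y where "Y z = eval_fps A (u z)" for z
  have u_pow: "u z ^ N = inverse z" if "z \<noteq> 0" for z
    using that N c by (simp add: u_def power_mult_distrib powr_def exp_of_nat_mult[symmetric])
  have inv: "(inverse \<longlongrightarrow> (0::complex)) at_infinity"
    by (rule tendsto_inverse_0)
  have "((\<lambda>z. norm (u z)) \<longlongrightarrow> 0) at_infinity"
  proof -
    have "norm c ^ N = 1 ^ N" using c by (simp flip: norm_power)
    then have "norm c = 1" by (rule power_eq_imp_eq_base) (use N in simp_all)
    then have "(\<lambda>z. norm (u z)) = (\<lambda>z. norm (inverse z) powr (1 / real N))"
      by (simp add: u_def norm_mult norm_powr_real_powr')
    moreover have "((\<lambda>z::complex. norm (inverse z) powr (1 / real N)) \<longlongrightarrow> 0) at_infinity"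
      using N by (intro tendsto_zero_powrI tendsto_norm_zero inv tendsto_const) auto
    ultimately show ?thesis by simp
  qed
  then have u0: "(u \<longlongrightarrow> 0) at_infinity" by (rule tendsto_norm_zero_cancel)
  have "isCont (eval_fps A) 0" using pos by (intro continuous_eval_fps) (simp add: zero_ereal_def)
  then have "((\<lambda>z. eval_fps A (u z)) \<longlongrightarrow> eval_fps A 0) at_infinity"
    using u0 by (rule isCont_tendsto_compose)
  then have Y_lim: "(Y \<longlongrightarrow> m) at_infinity"
    unfolding Y_def using A0 by (simp add: eval_fps_at_0)
  \<comment> \<open>A positive real inside the radius of convergence; u(z) tends to 0, so evaluation
    at u(z) is eventually legitimate.\<close>
  obtain R where R: "R > 0" "ereal R < fps_conv_radius A"
    using pos by (metis ereal_dense2 ereal_less(2))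
  have "\<forall>\<^sub>F z in at_infinity. norm (u z) < R"
    using order_tendstoD(2)[OF tendsto_norm_zero[OF u0] R(1)] .
  then have ev: "\<forall>\<^sub>F z in at_infinity. ereal (norm (u z)) < fps_conv_radius A"
    by eventually_elim (use R in \<open>metis ereal_less_eq(3) less_le_trans less_imp_le le_less_trans\<close>)
  let ?S = "\<lambda>z. - (\<Sum>k<d. inverse z ^ (d - 1 - k) * poly (hom_poly f k) (Y z)) / a"
  have "(?S \<longlongrightarrow> - (\<Sum>k<d. 0 ^ (d - 1 - k) * poly (hom_poly f k) m) / a) at_infinity"
    using \<open>a \<noteq> 0\<close> by (intro tendsto_intros inv Y_lim)
  \<comment> \<open>Here 0^(d-1-k) is 1 for k = d - 1 and 0 for every smaller k.\<close>
  moreover have "(\<Sum>k<d. 0 ^ (d - 1 - k) * poly (hom_poly f k) m) =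
      (\<Sum>k\<in>{d - 1}. 0 ^ (d - 1 - k) * poly (hom_poly f k) m)"
    using d by (intro sum.mono_neutral_right) auto
  moreover have "\<forall>\<^sub>F z in at_infinity.
      ?S z = (leaf_fun N (puiseux_conj c A) z - m * z) ^ d / z ^ (d - 1)"
    using ev eventually_not_equal_at_infinity[of 0]
  proof eventually_elim
    case (elim z)
    let ?w = "inverse z"
    have "0 = proj_closure f 1 (Y z) ?w"
      using eval_fps_proj_closure[OF elim(1), of f N] u_pow[OF elim(2)] root
      by (simp add: Y_def)
    also have "\<dots> = (\<Sum>k\<le>d. ?w ^ (d - k) * poly (hom_poly f k) (Y z))"
      by (simp add: proj_closure_def d poly_hom_poly)
    also have "{..d} = insert d {..<d}" by auto
    also have "(\<Sum>k\<in>insert d {..<d}. ?w ^ (d - k) * poly (hom_poly f k) (Y z)) =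
        a * (Y z - m) ^ d + (\<Sum>k<d. ?w ^ (d - k) * poly (hom_poly f k) (Y z))"
      by (simp add: top)
    also have "(\<Sum>k<d. ?w ^ (d - k) * poly (hom_poly f k) (Y z)) =
        ?w * (\<Sum>k<d. ?w ^ (d - 1 - k) * poly (hom_poly f k) (Y z))"
      unfolding sum_distrib_left
    proof (rule sum.cong[OF refl])
      fix k assume "k \<in> {..<d}"
      then have "d - k = Suc (d - 1 - k)" by auto
      then show "?w ^ (d - k) * poly (hom_poly f k) (Y z) =
          ?w * (?w ^ (d - 1 - k) * poly (hom_poly f k) (Y z))" by simp
    qed
    finally have "?S z = z * (Y z - m) ^ d"
      using \<open>a \<noteq> 0\<close> elim(2) by (simp add: field_simps add_eq_0_iff2)
    also have "\<dots> = (z * (Y z - m)) ^ d / z ^ (d - 1)"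
      using elim(2) d(2) by (cases d) (simp_all add: power_mult_distrib)
    also have "z * (Y z - m) = leaf_fun N (puiseux_conj c A) z - m * z"
      by (simp add: leaf_fun_def puiseux_eval_def eval_puiseux_conj Y_def u_def algebra_simps)
    finally show ?case .
  qed
  ultimately show ?thesis by (auto dest: Lim_transform_eventually)
qed

subsection \<open>Curves of lower degree\<close>

text \<open>With s = |x|^(1/d) one has |x| = s^d, and |w| grows like s^(d-1). A term x^i w^j then
  grows like s^(d i + (d-1) j), an exponent congruent to -j modulo d. Different j < d therefore give
  different exponents, and the largest one wins.\<close>

lemma eventually_poly2_nonzero:
  fixes h :: "complex poly poly" and x w :: "'a \<Rightarrow> complex"
  assumes "h \<noteq> 0" and deg: "degree h < d"
    and x: "filterlim x at_infinity F"
    and lim: "((\<lambda>n. norm (w n) ^ d / norm (x n) ^ (d - 1)) \<longlongrightarrow> \<gamma>) F" and "\<gamma> > 0"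
  shows "\<forall>\<^sub>F n in F. poly2 h (x n) (w n) \<noteq> 0"
proof -
  have d: "d > 0" using deg by simp
  \<comment> \<open>The d-th root turns all growth rates into powers with natural exponents.\<close>
  define s where "s n = root d (norm (x n))" for n
  define b where "b = root d \<gamma>"
  have b: "b > 0" using \<open>\<gamma> > 0\<close> d by (simp add: b_def)
  have normx: "norm (x n) = s n ^ d" for n using d by (simp add: s_def)
  have nx: "filterlim (\<lambda>n. norm (x n)) at_top F"
    using x by (simp add: filterlim_at_infinity_conv_norm_at_top)
  then have s: "filterlim s at_top F"
    unfolding filterlim_at_top
  proof safe
    fix Z
    assume "\<forall>Z. \<forall>\<^sub>F n in F. Z \<le> norm (x n)"
    then have "\<forall>\<^sub>F n in F. max Z 0 ^ d \<le> norm (x n)" by blast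
    then show "\<forall>\<^sub>F n in F. Z \<le> s n"
    proof eventually_elim
      case (elim n)
      then have "root d (max Z 0 ^ d) \<le> s n" unfolding s_def using d by simp
      then show ?case using d by (simp add: real_root_power_cancel)
    qed
  qed
  then have s_pos: "\<forall>\<^sub>F n in F. s n > 0"
    by (simp add: filterlim_at_top_dense)
  have w_lim: "((\<lambda>n. norm (w n) / s n ^ (d - 1)) \<longlongrightarrow> b) F"
  proof -
    have "((\<lambda>n. root d (norm (w n) ^ d / norm (x n) ^ (d - 1))) \<longlongrightarrow> b) F"
      unfolding b_def by (intro tendsto_intros lim)
    also have "(\<lambda>n. root d (norm (w n) ^ d / norm (x n) ^ (d - 1))) = (\<lambda>n. norm (w n) / s n ^ (d - 1))"
      using d by (simp add: real_root_divide real_root_power s_def real_root_power_cancel)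
    finally show ?thesis .
  qed
  \<comment> \<open>The growth exponent in s of the term \<open>T j\<close>: its coefficient behaves
    like its leading monomial in x, and \<open>l j\<close> is the limit of the normalised
    modulus.\<close>
  define e where "e j = d * degree (coeff h j) + (d - 1) * j" for j
  define T where "T j n = poly (coeff h j) (x n) * w n ^ j" for j n
  define l where "l j = norm (lead_coeff (coeff h j)) * b ^ j" for j
  have T: "((\<lambda>n. norm (T j n) / s n ^ e j) \<longlongrightarrow> l j) F" for j
  proof -
    have "((\<lambda>n. norm (poly (coeff h j) (x n) / x n ^ degree (coeff h j)) *
        (norm (w n) / s n ^ (d - 1)) ^ j) \<longlongrightarrow> l j) F"
      unfolding l_def
      by (intro tendsto_intros w_lim filterlim_compose[OF poly_divide_tendsto_aux x])
    also have "(\<lambda>n. norm (poly (coeff h j) (x n) / x n ^ degree (coeff h j)) *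
        (norm (w n) / s n ^ (d - 1)) ^ j) = (\<lambda>n. norm (T j n) / s n ^ e j)"
      by (simp add: T_def e_def norm_mult norm_divide norm_power normx power_add power_mult
          power_divide)
    finally show ?thesis .
  qed
  \<comment> \<open>Keeping only nonzero coefficients makes the limit \<open>l J\<close> of the
    dominant term positive.\<close>
  define S where "S = {j. j \<le> degree h \<and> coeff h j \<noteq> 0}"
  have "finite S" by (simp add: S_def)
  have "degree h \<in> S" using \<open>h \<noteq> 0\<close> by (simp add: S_def)
  have inj: "inj_on e S"
  proof (rule inj_onI)
    fix i j assume ij: "i \<in> S" "j \<in> S" "e i = e j"
    have dvd: "d dvd e k + k" for k
    proof -
      have "(d - 1) * k + k = d * k" using d by (cases d) auto
      then have "e k + k = d * (degree (coeff h k) + k)"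
        by (simp add: e_def algebra_simps)
      then show ?thesis by simp
    qed
    \<comment> \<open>Equal exponents would make d divide l - k, which lies strictly between 0 and
      d.\<close>
    have *: "\<not> k < l" if "l \<in> S" "e k = e l" for k l
    proof
      assume "k < l"
      have "d dvd (e l + l) - (e k + k)" by (intro dvd_diff_nat dvd)
      then have "d \<le> l - k" using that \<open>k < l\<close> by (intro dvd_imp_le) auto
      then show False using that(1) \<open>k < l\<close> deg unfolding S_def by auto
    qed
    show "i = j" using *[of j i] *[of i j] ij by auto
  qed
  define E where "E = Max (e ` S)"
  have "E \<in> e ` S" unfolding E_def using \<open>finite S\<close> \<open>degree h \<in> S\<close> by (intro Max_in) auto
  then obtain J where J: "J \<in> S" "e J = E" by auto
  have less: "e j < E" if "j \<in> S - {J}" for j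
  proof -
    have "e j \<le> E" unfolding E_def using that \<open>finite S\<close> by (intro Max_ge) auto
    moreover have "e j \<noteq> E" using inj J that by (auto dest: inj_onD)
    ultimately show ?thesis by simp
  qed
  have small: "((\<lambda>n. norm (T j n) / s n ^ E) \<longlongrightarrow> 0) F" if j: "j \<in> S - {J}" for j
  proof -
    have "((\<lambda>n. norm (T j n) / s n ^ e j * inverse (s n ^ (E - e j))) \<longlongrightarrow> l j * 0) F"
      using less[OF j] s
      by (intro tendsto_mult T tendsto_inverse_0_at_top filterlim_pow_at_top) auto
    moreover have "\<forall>\<^sub>F n in F. norm (T j n) / s n ^ e j * inverse (s n ^ (E - e j)) =
        norm (T j n) / s n ^ E"
      using s_pos
    proof eventually_elim
      case (elim n)
      have "s n ^ E = s n ^ e j * s n ^ (E - e j)" using less[OF j] by (simp flip: power_add)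
      then show ?case by (simp add: field_simps)
    qed
    ultimately show ?thesis by (auto dest: Lim_transform_eventually)
  qed
  \<comment> \<open>After division by s^E the dominant term minus all others has a positive limit,
    so the others cannot cancel it.\<close>
  have "((\<lambda>n. norm (T J n) / s n ^ E - (\<Sum>j\<in>S - {J}. norm (T j n) / s n ^ E)) \<longlongrightarrow>
      l J - (\<Sum>j\<in>S - {J}. 0)) F"
    using T[of J] J(2) by (intro tendsto_intros small) auto
  moreover have "l J - (\<Sum>j\<in>S - {J}. 0) > 0"
    using J(1) b by (simp add: l_def S_def)
  ultimately have "\<forall>\<^sub>F n in F. norm (T J n) / s n ^ E - (\<Sum>j\<in>S - {J}. norm (T j n) / s n ^ E) > 0"
    by (rule order_tendstoD)
  with s_pos show ?thesis
  proof eventually_elim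
    case (elim n)
    have "norm (T J n) / s n ^ E > (\<Sum>j\<in>S - {J}. norm (T j n)) / s n ^ E"
      using elim by (simp add: sum_divide_distrib)
    then have less': "(\<Sum>j\<in>S - {J}. norm (T j n)) < norm (T J n)"
      using elim by (simp add: divide_less_cancel)
    have "poly2 h (x n) (w n) = (\<Sum>j\<le>degree h. T j n)"
      by (simp add: poly2_def T_def poly_altdef[of h] poly_sum)
    also have "\<dots> = (\<Sum>j\<in>S. T j n)"
      by (rule sum.mono_neutral_right) (auto simp: S_def T_def)
    also have "\<dots> = T J n + (\<Sum>j\<in>S - {J}. T j n)"
      using \<open>finite S\<close> J(1) by (rule sum.remove)
    finally have eq: "poly2 h (x n) (w n) = T J n + (\<Sum>j\<in>S - {J}. T j n)" .
    show ?case
    proof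
      assume "poly2 h (x n) (w n) = 0"
      then have "T J n = - (\<Sum>j\<in>S - {J}. T j n)" using eq by (simp add: add_eq_0_iff2)
      then have "norm (T J n) \<le> (\<Sum>j\<in>S - {J}. norm (T j n))"
        by (simp add: norm_sum)
      then show False using less' by simp
    qed
  qed
qed

section \<open>Points of a curve and the shear y = m x + w\<close>

lemma poly_poly_eq:
  "poly (poly g p) x = poly (map_poly (\<lambda>c. poly c x) g) (poly p x)"
  by (induction g) (simp_all add: map_poly_pCons)

text \<open>\<open>infdist\<close> to the empty set is 0 by convention, so nonemptiness is what
  turns a small distance into a nearby point. If g involves y, fix x outside the roots of the
  leading coefficient and solve for y; otherwise solve for x.\<close>

lemma zero_set_nonempty:
  assumes "irreducible g"
  shows "zero_set g \<noteq> {}"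
proof -
  have "g \<noteq> 0" using assms by auto
  have "\<exists>x y. poly2 g x y = 0"
  proof (cases "degree g = 0")
    case True
    then obtain p where p: "g = [:p:]" by (rule degree_eq_zeroE)
    have "degree p > 0"
    proof (rule ccontr)
      assume "\<not> degree p > 0"
      then obtain c where "p = [:c:]" by (auto elim: degree_eq_zeroE)
      then show False using p assms \<open>g \<noteq> 0\<close> by (auto simp: irreducible_def is_unit_const_poly_iff dvd_field_iff)
    qed
    then obtain x where "poly p x = 0" using alg_closed_imp_poly_has_root by blast
    then show ?thesis using p by (auto simp: poly2_def)
  next
    case False
    have "\<not> (\<forall>x. poly (lead_coeff g) x = 0)"
      using \<open>g \<noteq> 0\<close> by (simp add: poly_all_0_iff_0)
    then obtain x where x: "poly (lead_coeff g) x \<noteq> 0" by blast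
    define q where "q = map_poly (\<lambda>c. poly c x) g"
    have "coeff q (degree g) \<noteq> 0" using x by (simp add: q_def coeff_map_poly)
    then have "degree q > 0" using False le_degree by fastforce
    then obtain y where "poly q y = 0" using alg_closed_imp_poly_has_root by blast
    moreover have "poly2 g x y = poly q y" for y
      by (simp add: q_def poly2_def poly_poly_eq)
    ultimately show ?thesis by metis
  qed
  then show ?thesis by (auto simp: zero_set_def)
qed

text \<open>The inner polynomial is w + m x, of degree 1 in w; composing with it preserves the
  degree in the outer variable.\<close>

lemma poly2_shear:
  "poly2 (pcompose g [:[:0, m:], 1:]) x w = poly2 g x (m * x + w)"
  by (simp add: poly2_def poly_pcompose poly_poly_eq[of g] algebra_simps)

text \<open>Points of the curve of g within distance 1 of the leaf have sheared coordinates (x, w)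
  at bounded distance from (z, r(z) - m z). Both z and r(z) - m z tend to infinity, so (x, w) has
  the same growth, which \<open>eventually_poly2_nonzero\<close> excludes for zeros of g.\<close>

lemma not_asymptotic_to_low_degree:
  fixes r :: "complex \<Rightarrow> complex"
  assumes g: "irreducible g" "total_degree g < d" and "d \<ge> 2"
    and lim: "((\<lambda>z. (r z - m * z) ^ d / z ^ (d - 1)) \<longlongrightarrow> L) at_infinity" and "L \<noteq> 0"
  shows "\<not> ((\<lambda>z. infdist (z, r z) (zero_set g)) \<longlongrightarrow> 0) at_infinity"
proof
  assume "((\<lambda>z. infdist (z, r z) (zero_set g)) \<longlongrightarrow> 0) at_infinity"
  then have infdist: "\<forall>\<^sub>F z in at_infinity. infdist (z, r z) (zero_set g) < 1"
    by (rule order_tendstoD) simp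
  have "\<exists>q. q \<in> zero_set g \<and> dist (z, r z) q < 1" if "infdist (z, r z) (zero_set g) < 1" for z
    using that zero_set_nonempty[OF g(1)] by (auto simp: infdist_notempty cINF_less_iff)
  then obtain p where p: "p z \<in> zero_set g \<and> dist (z, r z) (p z) < 1"
    if "infdist (z, r z) (zero_set g) < 1" for z
    by metis
  define x where "x z = fst (p z)" for z
  define w where "w z = snd (p z) - m * x z" for z
  define w0 where "w0 z = r z - m * z" for z
  have near: "\<forall>\<^sub>F z in at_infinity. poly2 g (x z) (m * x z + w z) = 0 \<and>
      norm (x z - z) \<le> 1 \<and> norm (w z - w0 z) \<le> 1 + norm m"
    using infdist
  proof eventually_elim
    case (elim z)
    note p = p[OF elim]
    have fst: "norm (x z - z) \<le> 1"
      using dist_fst_le[of "(z, r z)" "p z"] p by (simp add: x_def dist_norm norm_minus_commute)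
    have "norm (snd (p z) - r z) \<le> 1"
      using dist_snd_le[of "(z, r z)" "p z"] p by (simp add: dist_norm norm_minus_commute)
    moreover have "norm (m * (x z - z)) \<le> norm m"
      using mult_left_mono[OF fst, of "norm m"] by (simp add: norm_mult)
    moreover have "w z - w0 z = (snd (p z) - r z) - m * (x z - z)"
      by (simp add: w_def w0_def algebra_simps)
    ultimately have "norm (w z - w0 z) \<le> 1 + norm m"
      using norm_triangle_ineq4[of "snd (p z) - r z" "m * (x z - z)"] by simp
    then show ?case using p fst by (auto simp: zero_set_def x_def w_def)
  qed
  have norm_z: "filterlim (\<lambda>z::complex. norm z) at_top at_infinity"
    by (rule filterlim_norm_at_top)
  have x: "filterlim x at_infinity at_infinity"
    unfolding filterlim_at_infinity_conv_norm_at_top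
  proof (rule filterlim_at_top_mono)
    show "filterlim (\<lambda>z. - 1 + norm (z::complex)) at_top at_infinity"
      by (intro filterlim_tendsto_add_at_top[OF tendsto_const] norm_z)
    show "\<forall>\<^sub>F z in at_infinity. - 1 + norm z \<le> norm (x z)"
      using near
    proof eventually_elim
      case (elim z)
      then show ?case using norm_triangle_ineq2[of z "x z"] by (simp add: norm_minus_commute)
    qed
  qed
  \<comment> \<open>A bounded perturbation of a quantity tending to infinity has ratio 1 to it in
    the limit. It is applied to w / w0 and to x / z.\<close>
  have quotient: "((\<lambda>z. v z / v0 z) \<longlongrightarrow> 1) at_infinity"
    if v0: "filterlim (\<lambda>z. norm (v0 z)) at_top at_infinity"
      and v: "\<forall>\<^sub>F z in at_infinity. norm (v z - v0 z) \<le> K" for v v0 :: "complex \<Rightarrow> complex" and K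
  proof -
    have nz: "\<forall>\<^sub>F z in at_infinity. norm (v0 z) > 0"
      using v0 unfolding filterlim_at_top_dense by blast
    have "((\<lambda>z. v z / v0 z - 1) \<longlongrightarrow> 0) at_infinity"
    proof (rule Lim_null_comparison)
      show "((\<lambda>z. K / norm (v0 z)) \<longlongrightarrow> 0) at_infinity"
        by (intro tendsto_divide_0[OF tendsto_const] filterlim_at_top_imp_at_infinity v0)
      show "\<forall>\<^sub>F z in at_infinity. norm (v z / v0 z - 1) \<le> K / norm (v0 z)"
        using v nz
      proof eventually_elim
        case (elim z)
        then have "v z / v0 z - 1 = (v z - v0 z) / v0 z" by (simp add: field_simps)
        then show ?case using elim by (simp add: norm_divide divide_right_mono)
      qed
    qed
    then show ?thesis by (simp add: LIM_zero_iff)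
  qed
  \<comment> \<open>The d-th power of |w0| grows like |z|^(d-1), and d >= 2 makes this exponent
    positive.\<close>
  have w0: "filterlim (\<lambda>z. norm (w0 z)) at_top at_infinity"
  proof -
    have "filterlim (\<lambda>z. norm ((r z - m * z) ^ d / z ^ (d - 1)) * norm z ^ (d - 1)) at_top at_infinity"
      using \<open>L \<noteq> 0\<close> \<open>d \<ge> 2\<close>
      by (intro filterlim_tendsto_pos_mult_at_top[OF tendsto_norm[OF lim]] filterlim_pow_at_top norm_z)
        auto
    moreover have "\<forall>\<^sub>F z in at_infinity.
        norm ((r z - m * z) ^ d / z ^ (d - 1)) * norm z ^ (d - 1) = norm (w0 z) ^ d"
      using eventually_not_equal_at_infinity[of 0]
      by eventually_elim (simp add: w0_def norm_divide norm_power)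
    ultimately have *: "filterlim (\<lambda>z. norm (w0 z) ^ d) at_top at_infinity"
      by (rule filterlim_cong[THEN iffD1, OF refl refl, rotated])
    show ?thesis
      unfolding filterlim_at_top
    proof
      fix Z :: real
      have "\<forall>\<^sub>F z in at_infinity. max Z 0 ^ d < norm (w0 z) ^ d"
        using * unfolding filterlim_at_top_dense by blast
      then show "\<forall>\<^sub>F z in at_infinity. Z \<le> norm (w0 z)"
      proof eventually_elim
        case (elim z)
        then have "max Z 0 < norm (w0 z)" by (rule power_less_imp_less_base) simp
        then show ?case by simp
      qed
    qed
  qed
  \<comment> \<open>The known limit is multiplied by two correction factors with limit 1, so that w0
    and z cancel and |w|^d / |x|^(d-1) remains.\<close>
  have "((\<lambda>z. norm ((r z - m * z) ^ d / z ^ (d - 1)) * norm (w z / w0 z) ^ d /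
      norm (x z / z) ^ (d - 1)) \<longlongrightarrow> norm L * norm (1::complex) ^ d / norm (1::complex) ^ (d - 1))
      at_infinity"
    by (intro tendsto_intros lim quotient[OF w0] quotient[OF norm_z]
        eventually_mono[OF near]) auto
  moreover have "\<forall>\<^sub>F z in at_infinity. norm ((r z - m * z) ^ d / z ^ (d - 1)) *
      norm (w z / w0 z) ^ d / norm (x z / z) ^ (d - 1) = norm (w z) ^ d / norm (x z) ^ (d - 1)"
    using eventually_not_equal_at_infinity[of 0] filterlim_at_top_dense[THEN iffD1, OF w0, rule_format, of 0]
    by eventually_elim (simp add: w0_def norm_divide norm_power power_divide)
  ultimately have ratio: "((\<lambda>z. norm (w z) ^ d / norm (x z) ^ (d - 1)) \<longlongrightarrow> norm L) at_infinity"
    by (auto dest: Lim_transform_eventually)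
  define h where "h = pcompose g [:[:0, m:], 1:]"
  have "h \<noteq> 0" using g(1) pcompose_eq_0[of g "[:[:0, m:], 1:]"] by (auto simp: h_def)
  moreover have "degree h < d"
    using degree_le_total_degree[of g] g(2) by (simp add: h_def degree_pcompose)
  ultimately have "\<forall>\<^sub>F z in at_infinity. poly2 h (x z) (w z) \<noteq> 0"
    using x ratio \<open>L \<noteq> 0\<close> by (intro eventually_poly2_nonzero) auto
  then have "\<forall>\<^sub>F z in at_infinity. poly2 h (x z) (w z) \<noteq> 0 \<and> poly2 g (x z) (m * x z + w z) = 0"
    using near by eventually_elim simp
  then have "\<exists>z. poly2 h (x z) (w z) \<noteq> 0 \<and> poly2 g (x z) (m * x z + w z) = 0"
    by (rule eventually_happens'[OF trivial_limit_at_infinity])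
  then obtain z where "poly2 h (x z) (w z) \<noteq> 0" "poly2 g (x z) (m * x z + w z) = 0"
    by auto
  then show False by (simp add: h_def poly2_shear)
qed

subsection \<open>Perfect curves\<close>

text \<open>The first assumption says that y^d occurs in the leading form. In a proper factorization
  both leading forms then have full positive degree in y, so each has a root, which must be m; by
  \<open>hom_poly_mult_subtop\<close> the second form of f would vanish there.\<close>

lemma irreducible_if_unique_infinity_root:
  fixes f :: "'a::{alg_closed_field,ring_char_0} poly poly"
  assumes deg: "degree (hom_poly f (total_degree f)) = total_degree f" "total_degree f > 0"
    and root: "\<And>y. poly (hom_poly f (total_degree f)) y = 0 \<Longrightarrow> y = m"
    and regular: "total_degree f \<ge> 2 \<Longrightarrow> poly (hom_poly f (total_degree f - 1)) m \<noteq> 0"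
  shows "irreducible f"
proof (rule irreducibleI)
  show "f \<noteq> 0" using deg by (auto simp: hom_poly_def)
  show "\<not> f dvd 1" using deg(2) is_unit_imp_total_degree_eq_0[of f] by auto
  fix g h assume f: "f = g * h"
  have nz: "g \<noteq> 0" "h \<noteq> 0" using \<open>f \<noteq> 0\<close> f by auto
  show "g dvd 1 \<or> h dvd 1"
  proof (rule ccontr)
    assume "\<not> (g dvd 1 \<or> h dvd 1)"
    then have "total_degree g \<noteq> 0" "total_degree h \<noteq> 0"
      using is_unit_if_total_degree_eq_0 nz by auto
    then obtain a b where a: "total_degree g = Suc a" and b: "total_degree h = Suc b"
      by (meson not0_implies_Suc)
    let ?G = "hom_poly g (Suc a)" and ?H = "hom_poly h (Suc b)"
    have d: "total_degree f = Suc (Suc (a + b))"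
      using total_degree_mult[OF nz] a b f by simp
    have top: "hom_poly f (total_degree f) = ?G * ?H"
      using hom_poly_mult_top[of g h] a b d f by simp
    have "?G \<noteq> 0" "?H \<noteq> 0" using hom_poly_total_degree_nonzero nz a b by metis+
    then have "degree ?G + degree ?H = Suc a + Suc b"
      using deg(1) d top by (simp add: degree_mult_eq)
    then have "degree ?G > 0" "degree ?H > 0"
      using degree_hom_poly_le[of g "Suc a"] degree_hom_poly_le[of h "Suc b"] by auto
    then obtain y z where yz: "poly ?G y = 0" "poly ?H z = 0"
      using alg_closed_imp_poly_has_root by metis
    then have "y = m" "z = m" using root top by auto
    then have "poly (hom_poly f (Suc (a + b))) m = 0"
      using hom_poly_mult_subtop[OF a b] yz f by simp
    then show False using regular d by simp
  qed
qed

text \<open>On the line z = 0 the form is c (y - m x)^d with d >= 2, so the partial derivatives in x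
  and y vanish at the point. Regularity rests on the derivative in z, which is f_{d-1}(a, m
  a).\<close>

lemma regular_infinity_point_imp_subtop_nonzero:
  fixes f :: "complex poly poly"
  assumes top: "hom_poly f (total_degree f) = smult c ([:-m, 1:] ^ total_degree f)"
    and d: "total_degree f \<ge> 2" and "a \<noteq> 0"
    and regular: "regular_point f (a, m * a, 0)"
  shows "poly (hom_poly f (total_degree f - 1)) m \<noteq> 0"
proof -
  define d where "d = total_degree f"
  have d2: "d \<ge> 2" using d by (simp add: d_def)
  have z0: "proj_closure f x y 0 = hom_part f d x y" for x y
  proof -
    have "proj_closure f x y 0 = (\<Sum>k\<in>{d}. 0 ^ (d - k) * hom_part f k x y)"
      unfolding proj_closure_def d_def by (rule sum.mono_neutral_right) auto
    then show ?thesis by simp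
  qed
  have form: "proj_closure f x y 0 = c * (y - m * x) ^ d" if "x \<noteq> 0" for x y
    using that top hom_part_eq[OF that, of f d y]
    by (simp add: z0 d_def power_mult_distrib[symmetric] algebra_simps)
  \<comment> \<open>The closed form is available only for x different from 0, hence on a
    neighbourhood of a.\<close>
  have "deriv (\<lambda>t. proj_closure f t (m * a) 0) a = deriv (\<lambda>t. c * (m * a - m * t) ^ d) a"
    using eventually_neq_at_within[of 0 a UNIV] t1_space_nhds[OF \<open>a \<noteq> 0\<close>]
    by (intro deriv_cong_ev refl) (auto elim!: eventually_mono simp: form)
  also have "\<dots> = 0"
    using d2 by (intro DERIV_imp_deriv) (auto intro!: derivative_eq_intros)
  finally have dx: "deriv (\<lambda>t. proj_closure f t (m * a) 0) a = 0" .
  have "deriv (\<lambda>t. proj_closure f a t 0) (m * a) = deriv (\<lambda>t. c * (t - m * a) ^ d) (m * a)"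
    using \<open>a \<noteq> 0\<close> by (simp add: form)
  also have "\<dots> = 0"
    using d2 by (intro DERIV_imp_deriv) (auto intro!: derivative_eq_intros)
  finally have dy: "deriv (\<lambda>t. proj_closure f a t 0) (m * a) = 0" .
  have "((\<lambda>t. proj_closure f a (m * a) t) has_field_derivative
      (\<Sum>k\<le>d. of_nat (d - k) * 0 ^ (d - k - 1) * hom_part f k a (m * a))) (at 0)"
    unfolding proj_closure_def d_def
    by (auto intro!: derivative_eq_intros sum.cong)
  then have "deriv (\<lambda>t. proj_closure f a (m * a) t) 0 =
      (\<Sum>k\<le>d. of_nat (d - k) * 0 ^ (d - k - 1) * hom_part f k a (m * a))"
    by (rule DERIV_imp_deriv)
  \<comment> \<open>For k = d the factor d - k is 0, although the truncated exponent makes the power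
    of 0 equal to 1; for k < d - 1 the power of 0 vanishes.\<close>
  also have "\<dots> = (\<Sum>k\<in>{d - 1}. of_nat (d - k) * 0 ^ (d - k - 1) * hom_part f k a (m * a))"
    using d2 by (intro sum.mono_neutral_right) (auto simp: power_0_left)
  also have "\<dots> = hom_part f (d - 1) a (m * a)" using d2 by (simp add: of_nat_diff)
  also have "\<dots> = a ^ (d - 1) * poly (hom_poly f (d - 1)) m"
    using hom_part_eq[OF \<open>a \<noteq> 0\<close>] \<open>a \<noteq> 0\<close> by simp
  finally show ?thesis
    using regular dx dy by (auto simp: regular_point_def d_def)
qed

text \<open>As (0 : 1 : 0) is excluded, P can be written (1 : m : 0), the polynomial q_d has degree
  exactly d, and its roots are precisely the infinity points. So q_d is a multiple of (y - m)^d and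
  the preceding results apply.\<close>

lemma perfect_curve_if_unique_regular_infinity_point:
  assumes no_vertical: "\<not> infinity_point f (0, 1)"
    and P: "infinity_point f P"
    and unique: "\<And>Q. infinity_point f Q \<Longrightarrow> proj_eq Q P"
    and regular: "regular_point f (fst P, snd P, 0)"
  shows "perfect_curve f"
proof -
  define d where "d = total_degree f"
  define a where "a = fst P"
  define m where "m = snd P / a"
  let ?q = "hom_poly f d"
  have "hom_part f d 0 1 = coeff ?q d"
  proof -
    have "hom_part f d 0 1 = (\<Sum>i\<in>{0}. coeff (coeff f (d - i)) i * 0 ^ i * 1 ^ (d - i))"
      unfolding hom_part_def by (rule sum.mono_neutral_right) auto
    then show ?thesis by (simp add: coeff_hom_poly)
  qed
  then have coeff_q: "coeff ?q d \<noteq> 0"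
    using no_vertical by (simp add: infinity_point_def d_def)
  then have deg_q: "degree ?q = d"
    by (intro antisym degree_hom_poly_le le_degree)
  have "a \<noteq> 0"
  proof
    assume "a = 0"
    then have "snd P \<noteq> 0" "hom_part f d 0 (snd P) = 0"
      using P by (auto simp: infinity_point_def a_def d_def split: prod.splits)
    then have "hom_part f d 0 1 = 0"
      using hom_part_scale[of f d "snd P" 0 1] by simp
    then show False using no_vertical by (simp add: infinity_point_def d_def)
  qed
  then have P_eq: "P = (a, m * a)" by (simp add: a_def m_def)
  have root_iff: "poly ?q y = 0 \<longleftrightarrow> infinity_point f (1, y)" for y
    by (simp add: infinity_point_def poly_hom_poly d_def)
  have root: "y = m" if "infinity_point f (1, y)" for y
    using unique[OF that] \<open>a \<noteq> 0\<close> by (auto simp: proj_eq_def P_eq field_simps)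
  have "hom_part f d a (m * a) = 0"
    using P by (simp add: P_eq infinity_point_def d_def)
  then have "poly ?q m = 0"
    using hom_part_eq[OF \<open>a \<noteq> 0\<close>, of f d "m * a"] \<open>a \<noteq> 0\<close> by simp
  have "?q \<noteq> 0" using coeff_q by auto
  then have "d > 0"
    using \<open>poly ?q m = 0\<close> deg_q by (metis degree_eq_zeroE gr0I poly_const_conv pCons_0_0)
  have top: "?q = smult (lead_coeff ?q) ([:-m, 1:] ^ d)"
    using power_linear_if_unique_root[OF \<open>?q \<noteq> 0\<close>, of m] root root_iff deg_q by auto
  have sub: "poly (hom_poly f (d - 1)) m \<noteq> 0" if "d \<ge> 2"
    using regular_infinity_point_imp_subtop_nonzero[of f _ m a] top that regular \<open>a \<noteq> 0\<close>
    unfolding d_def[symmetric] P_eq by simp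
  have irred: "irreducible f"
    using irreducible_if_unique_infinity_root[of f m] deg_q \<open>d > 0\<close> root root_iff sub
    unfolding d_def by blast
  have "\<not> approaches_at g f B" if g: "irreducible g" "total_degree g < d" for g B
  proof
    assume "approaches_at g f B"
    then obtain m' N A M c where branch: "branch_data f m' N A M" and c: "c ^ N = 1"
      and lim: "((\<lambda>z. infdist (z, leaf_fun N (puiseux_conj c A) z) (zero_set g)) \<longlongrightarrow> 0) at_infinity"
      by (auto simp: approaches_at_def)
    have "m' = m" using branch root by (simp add: branch_data_def)
    \<comment> \<open>An irreducible g is not a unit, so a curve of lower degree exists only when d
      >= 2, the case in which regularity gives a nonzero limit along the leaf.\<close>
    have "total_degree g \<noteq> 0"
      using is_unit_if_total_degree_eq_0[of g] g(1) by (auto simp: irreducible_def)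
    then have "d \<ge> 2" using g(2) by simp
    have "lead_coeff ?q \<noteq> 0" using \<open>?q \<noteq> 0\<close> by simp
    then show False
      using not_asymptotic_to_low_degree[OF g \<open>d \<ge> 2\<close>
          leaf_fun_tendsto[OF branch[unfolded \<open>m' = m\<close>] c _ \<open>d > 0\<close> top]] lim sub[OF \<open>d \<ge> 2\<close>]
      by (simp add: d_def)
  qed
  then show ?thesis
    using irred no_vertical by (auto simp: perfect_curve_def d_def)
qed

theorem proposition4p6:
  fixes f :: "real poly poly" and P :: "complex \<times> complex"
  assumes "irreducible f"
    and "\<not> infinity_point (map_poly2 complex_of_real f) (0, 1)"
    and "infinity_point (map_poly2 complex_of_real f) P"
    and "\<And>Q. infinity_point (map_poly2 complex_of_real f) Q \<Longrightarrow> proj_eq Q P"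
    and "regular_point (map_poly2 complex_of_real f) (fst P, snd P, 0)"
  shows "perfect_curve (map_poly2 complex_of_real f)"
  using assms(2-5) by (rule perfect_curve_if_unique_regular_infinity_point)

end
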